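(* Let $G$ be a finite forest with maximum degree $\Delta(G)\le 4$. Then $\mu_g(G)\le 3$, where $\mu_g(G)$ is the majority game chromatic number of $G$.
   Context: All graphs are finite and simple. Let $G$ be a graph and $C$ a finite set of colors. A partial coloring of $G$ (an assignment of colors from $C$ to some of the vertices) satisfies the majority condition if every colored vertex $v$ has at most $\lfloor \deg(v)/2\rfloor$ colored neighbors of the same color as $v$ (here $\deg(v)$ is the degree of $v$ in $G$). The majority coloring game on $G$ with palette $C$: two players, Alice and Bob, alternately move, with Alice moving first. In a move the player chooses an uncolored vertex and assigns it a color from $C$ so that the resulting partial coloring still satisfies the majority condition (at every colored vertex). Alice wins if all vertices are eventually colored; otherwise (if at some point an uncolored vertex exists but no legal completion of the play is reached, i.e. the whole graph does not get colored) Bob wins. The majority game chromatic number $\mu_g(G)$ is the least number of colors for which Alice has a winning strategy. *)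

theory Defs
  imports "Graph_Theory.Pair_Digraph"
begin

section \<open>Finite simple graphs\<close>

text \<open>
  A finite simple graph is a \<open>pair_graph\<close>: a finite vertex set with a symmetric, irreflexive set of
  ordered pairs, an edge \<open>uv\<close> being present as the two arcs \<open>(u, v)\<close> and \<open>(v, u)\<close>.  Hence the degree
  of \<open>v\<close> is \<open>out_degree G v\<close>.
\<close>

definition neighbors :: "'a pair_pre_digraph \<Rightarrow> 'a \<Rightarrow> 'a set" where
  "neighbors G v = {w. (v, w) \<in> parcs G}"

text \<open>The \<open>0\<close> only matters for the graph without vertices.\<close>

definition max_degree :: "'a pair_pre_digraph \<Rightarrow> nat" where
  "max_degree G = Max (insert 0 (out_degree G ` pverts G))"

text \<open>
  The constant \<open>forest\<close> of \<open>Graph_Theory\<close> is not usable here: \<open>cycle\<close> is a notion for digraphs, so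
  that every edge \<open>uv\<close> of a symmetric digraph yields the cycle \<open>u, v, u\<close>.  The cycles of the
  undirected graph are those of length at least three.
\<close>

definition undirected_forest :: "'a pair_pre_digraph \<Rightarrow> bool" where
  "undirected_forest G \<longleftrightarrow> \<not> (\<exists>p. pre_digraph.cycle (with_proj G) p \<and> 3 \<le> length p)"


section \<open>The majority coloring game\<close>

text \<open>Partial colorings are maps; \<open>c v = None\<close> means that \<open>v\<close> is uncolored.\<close>

definition majority_condition :: "'a pair_pre_digraph \<Rightarrow> ('a \<rightharpoonup> 'c) \<Rightarrow> bool" where
  "majority_condition G c \<longleftrightarrow>
     (\<forall>v \<in> dom c. card {w \<in> neighbors G v. c w = c v} \<le> out_degree G v div 2)"

type_synonym ('a, 'c) move = "'a \<times> 'c"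

fun legal_move :: "'a pair_pre_digraph \<Rightarrow> 'c set \<Rightarrow> ('a \<rightharpoonup> 'c) \<Rightarrow> ('a, 'c) move \<Rightarrow> bool" where
  "legal_move G C c (v, a) \<longleftrightarrow>
     v \<in> pverts G \<and> c v = None \<and> a \<in> C \<and> majority_condition G (c(v \<mapsto> a))"

text \<open>
  A play is the list of the moves made so far, in chronological order.  No vertex is colored twice,
  so the partial coloring reached by \<open>ms\<close> is \<open>map_of ms\<close>.
\<close>

inductive legal_play :: "'a pair_pre_digraph \<Rightarrow> 'c set \<Rightarrow> ('a, 'c) move list \<Rightarrow> bool"
  for G C where
  start: "legal_play G C []"
| move: "legal_play G C ms \<Longrightarrow> legal_move G C (map_of ms) m \<Longrightarrow> legal_play G C (ms @ [m])"

definition game_over :: "'a pair_pre_digraph \<Rightarrow> 'c set \<Rightarrow> ('a, 'c) move list \<Rightarrow> bool" where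
  "game_over G C ms \<longleftrightarrow> \<not> (\<exists>m. legal_move G C (map_of ms) m)"

text \<open>Alice moves first, so it is her turn exactly after an even number of moves.\<close>

type_synonym ('a, 'c) strategy = "('a, 'c) move list \<Rightarrow> ('a, 'c) move"

definition alice_strategy :: "'a pair_pre_digraph \<Rightarrow> 'c set \<Rightarrow> ('a, 'c) strategy \<Rightarrow> bool" where
  "alice_strategy G C \<sigma> \<longleftrightarrow>
     (\<forall>ms. legal_play G C ms \<and> even (length ms) \<and> \<not> game_over G C ms
        \<longrightarrow> legal_move G C (map_of ms) (\<sigma> ms))"

definition alice_follows :: "('a, 'c) strategy \<Rightarrow> ('a, 'c) move list \<Rightarrow> bool" where
  "alice_follows \<sigma> ms \<longleftrightarrow> (\<forall>i < length ms. even i \<longrightarrow> ms ! i = \<sigma> (take i ms))"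

definition alice_winning_strategy :: "'a pair_pre_digraph \<Rightarrow> 'c set \<Rightarrow> ('a, 'c) strategy \<Rightarrow> bool" where
  "alice_winning_strategy G C \<sigma> \<longleftrightarrow>
     alice_strategy G C \<sigma> \<and>
     (\<forall>ms. legal_play G C ms \<and> alice_follows \<sigma> ms \<and> game_over G C ms
        \<longrightarrow> dom (map_of ms) = pverts G)"

definition alice_wins :: "'a pair_pre_digraph \<Rightarrow> 'c set \<Rightarrow> bool" where
  "alice_wins G C \<longleftrightarrow> (\<exists>\<sigma>. alice_winning_strategy G C \<sigma>)"

text \<open>
  Alice wins with \<open>card (pverts G)\<close> colors (lemma \<open>alice_wins_card_verts\<close> below), so for finite
  graphs the minimum is taken over a nonempty set.  Only the number of colors matters, so \<open>{..<k}\<close>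
  stands for an arbitrary palette of \<open>k\<close> colors.
\<close>

definition majority_game_chromatic_number :: "'a pair_pre_digraph \<Rightarrow> nat" where
  "majority_game_chromatic_number G = (LEAST k. alice_wins G {..<k})"


section \<open>The majority game chromatic number is well defined\<close>

lemma map_of_snoc: "map_of ms v = None \<Longrightarrow> map_of (ms @ [(v, a)]) = (map_of ms)(v \<mapsto> a)"
  by (auto simp: map_add_def fun_eq_iff split: option.splits)

lemma legal_play_dom: "legal_play G C ms \<Longrightarrow> dom (map_of ms) \<subseteq> pverts G"
proof (induction rule: legal_play.induct)
  case (move ms m)
  then show ?case by (cases m) (simp del: map_of_append fun_upd_apply add: map_of_snoc)
qed simp

lemma legal_play_majority: "legal_play G C ms \<Longrightarrow> majority_condition G (map_of ms)"
proof (induction rule: legal_play.induct)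
  case start
  then show ?case by (simp add: majority_condition_def)
next
  case (move ms m)
  then show ?case by (cases m) (simp del: map_of_append fun_upd_apply add: map_of_snoc)
qed

lemma legal_move_fresh_color:
  assumes "majority_condition G c" "v \<in> pverts G" "c v = None" "a \<in> C" "a \<notin> ran c"
    and "pair_graph G"
  shows "legal_move G C c (v, a)"
proof -
  interpret pair_graph G by fact
  have "card {w \<in> neighbors G u. (c(v \<mapsto> a)) w = (c(v \<mapsto> a)) u} \<le> out_degree G u div 2"
    if u: "u \<in> dom (c(v \<mapsto> a))" for u
  proof (cases "u = v")
    case True
    have "{w \<in> neighbors G u. (c(v \<mapsto> a)) w = (c(v \<mapsto> a)) u} = {}"
      using assms(5) True by (auto simp: neighbors_def ran_def dest: pair_no_loops)
    then show ?thesis by (simp only: card.empty zero_le)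
  next
    case False
    then have "c u \<noteq> Some a" using assms(5) by (auto simp: ran_def)
    then have "{w \<in> neighbors G u. (c(v \<mapsto> a)) w = (c(v \<mapsto> a)) u} = {w \<in> neighbors G u. c w = c u}"
      using False u assms(3) by auto
    then show ?thesis using assms(1) False u by (auto simp: majority_condition_def)
  qed
  then have "majority_condition G (c(v \<mapsto> a))"
    unfolding majority_condition_def by blast
  then show ?thesis using assms by simp
qed

lemma alice_wins_card_verts:
  assumes "pair_graph G"
  shows "alice_wins G {..<card (pverts G)}"
proof -
  interpret pair_graph G by fact
  let ?C = "{..<card (pverts G)}"
  define \<sigma> where "\<sigma> ms = (SOME m. legal_move G ?C (map_of ms) m)" for ms
  have "alice_strategy G ?C \<sigma>"
    unfolding alice_strategy_def game_over_def \<sigma>_def by (metis someI_ex)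
  moreover have "dom (map_of ms) = pverts G" if ms: "legal_play G ?C ms" "game_over G ?C ms" for ms
  proof (rule ccontr)
    assume "dom (map_of ms) \<noteq> pverts G"
    then have psub: "dom (map_of ms) \<subset> pverts G" using legal_play_dom[OF ms(1)] by blast
    then obtain v where v: "v \<in> pverts G" "map_of ms v = None" by blast
    have "ran (map_of ms) = the ` map_of ms ` dom (map_of ms)"
      by (force simp: ran_def image_iff)
    then have "card (ran (map_of ms)) \<le> card (dom (map_of ms))"
      by (metis card_image_le finite_dom_map_of finite_imageI order_trans)
    also have "\<dots> < card ?C"
      using psubset_card_mono[OF pair_finite_verts psub] by simp
    finally have "\<not> ?C \<subseteq> ran (map_of ms)"
      using card_mono[OF finite_ran[OF finite_dom_map_of]] by (meson leD)
    then obtain a where "a \<in> ?C" "a \<notin> ran (map_of ms)" by blast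
    then have "legal_move G ?C (map_of ms) (v, a)"
      by (rule legal_move_fresh_color[OF legal_play_majority[OF ms(1)] v _ _ assms])
    then have "\<exists>m. legal_move G ?C (map_of ms) m" by (rule exI)
    then show False using ms(2) by (simp only: game_over_def not_True_eq_False)
  qed
  ultimately show ?thesis
    unfolding alice_wins_def alice_winning_strategy_def by blast
qed

lemma alice_wins_majority_game_chromatic_number:
  assumes "pair_graph G"
  shows "alice_wins G {..<majority_game_chromatic_number G}"
  unfolding majority_game_chromatic_number_def
  using alice_wins_card_verts[OF assms] by (rule LeastI)

end

theory Submission
  imports Defs
begin

text \<open>
  Root every tree of the forest, and call a vertex saturated if it has as many neighbors of its own
  color as the majority condition permits.  A color is forbidden at an uncolored vertex only if a
  saturated neighbor has it or more than half of the neighbors have it.  Alice keeps every saturated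
  vertex from having an uncolored parent.  An uncolored vertex then has at most one saturated
  neighbor, its parent; of the two colors other than that of the parent, the rarer one is admissible,
  so nobody gets stuck.

  A move of Bob at \<open>x\<close> breaks this at no more than one place.  It affects only \<open>x\<close> and the neighbors
  of \<open>x\<close>; a child of \<open>x\<close> has a colored parent from now on.  If the parent of \<open>x\<close> is uncolored, only
  \<open>x\<close> itself can violate the rule, and if it is colored, only this parent can.

  Alice repairs the violation at \<open>a\<close> by coloring the parent \<open>n\<close> of \<open>a\<close>.  Every colored child of \<open>n\<close>
  except \<open>a\<close> is unsaturated, so it may share its color with \<open>n\<close>, and becoming saturated does not
  hurt it since its parent is now colored.  She avoids the color of \<open>a\<close>, and also the color of the
  parent \<open>w\<close> of \<open>n\<close> if there is one, so that \<open>w\<close> does not become saturated.  If \<open>w\<close> is colored,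
  the remaining color occurs on at most \<open>deg n - 2\<close> neighbors of \<open>n\<close>, and this is at most
  \<open>\<lfloor>deg n / 2\<rfloor>\<close> because \<open>deg n \<le> 4\<close>.  If \<open>w\<close> is uncolored, then \<open>n\<close> must itself stay
  unsaturated; now two colors are left for it, which share at most \<open>deg n - 2\<close> neighbors, so that
  one of them occurs on fewer than \<open>\<lfloor>deg n / 2\<rfloor>\<close> neighbors.  When there is nothing to repair, she
  colors an uncolored vertex without uncolored parent.

  This is the content of \<open>legal_move_almost_safe\<close> (Bob) and \<open>ex_safe_move\<close> (Alice).  The roots come
  from an elimination order of the forest, \<open>forest_ex_rank\<close>: every vertex has at most one neighbor
  that is removed later, and this neighbor serves as its parent.
\<close>

section \<open>Ordering a forest\<close>

context pair_graph
begin

lemma finite_neighbors: "finite (neighbors G v)"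
  by (rule finite_subset[of _ "snd ` parcs G"]) (force simp: neighbors_def pair_finite_arcs)+

lemma out_degree_eq_card_neighbors: "out_degree G v = card (neighbors G v)"
proof -
  have "out_arcs G v = Pair v ` neighbors G v"
    by (auto simp: out_arcs_def neighbors_def)
  then show ?thesis by (simp add: out_degree_def card_image inj_on_def)
qed

lemma neighbors_sym: "w \<in> neighbors G v \<longleftrightarrow> v \<in> neighbors G w"
  by (auto simp: neighbors_def dest: arcs_symmetric)

lemma not_neighbor_self: "v \<notin> neighbors G v"
  by (auto simp: neighbors_def dest: no_loops')

lemma neighbors_subset_pverts: "neighbors G v \<subseteq> pverts G"
  by (auto simp: neighbors_def dest: in_arcsD2)

text \<open>
  Otherwise the first vertex of a longest path within \<open>S\<close> has, besides its successor on the path,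
  a second neighbor in \<open>S\<close>.  That neighbor lies on the path as well and closes a cycle.
\<close>

lemma forest_ex_end_vertex:
  assumes forest: "undirected_forest G" and S: "S \<subseteq> pverts G" "S \<noteq> {}"
  shows "\<exists>v\<in>S. card (neighbors G v \<inter> S) \<le> 1"
proof (rule ccontr)
  assume "\<not> ?thesis"
  then have two: "2 \<le> card (neighbors G v \<inter> S)" if "v \<in> S" for v
    using that by force
  have finS: "finite S" using S(1) pair_finite_verts finite_subset by blast
  define P where "P = (\<lambda>(u, p, v). apath u p v \<and> set (awalk_verts u p) \<subseteq> S)"
  obtain s where "s \<in> S" using S(2) by blast
  then have ex: "P (s, [], s)" using S(1) by (auto simp: P_def apath_Nil_iff)
  have bound: "length (fst (snd t)) < Suc (card S)" if "P t" for t
  proof -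
    obtain u p v where t: "t = (u, p, v)" by (cases t)
    have "distinct (awalk_verts u p)" "set (awalk_verts u p) \<subseteq> S"
      using that t by (auto simp: P_def apath_def)
    then have "length (awalk_verts u p) \<le> card S"
      by (metis finS card_mono distinct_card)
    then show ?thesis using t length_awalk_verts[of u p] by simp
  qed
  then have "\<forall>t. P t \<longrightarrow> length (fst (snd t)) < Suc (card S)" by blast
  from ex_has_greatest_nat[of P, OF ex this] obtain t where t: "P t"
    "\<forall>t'. P t' \<longrightarrow> length (fst (snd t')) \<le> length (fst (snd t))" by (elim exE conjE)
  obtain u p v where upv: "t = (u, p, v)" by (cases t)
  have max: "P (u, p, v)" using t(1) upv by simp
  have longest: "length p' \<le> length p" if "P (u', p', v')" for u' p' v'
    using t(2)[rule_format, OF that] upv by simp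
  have path: "apath u p v" and verts: "set (awalk_verts u p) \<subseteq> S"
    using max by (auto simp: P_def)
  have "u \<in> S" using verts path hd_in_awalk_verts by blast
  \<comment> \<open>A neighbor outside the path would extend it at the front.\<close>
  have on_path: "w \<in> set (awalk_verts u p)" if "w \<in> neighbors G u" "w \<in> S" for w
  proof (rule ccontr)
    assume "w \<notin> set (awalk_verts u p)"
    moreover have "(w, u) \<in> parcs G" using that(1) by (auto simp: neighbors_def dest: arcs_symmetric)
    ultimately have "P (w, (w, u) # p, v)"
      using path verts that(2) by (auto simp: P_def apath_Cons_iff)
    then show False using longest by fastforce
  qed
  \<comment> \<open>If the path has no arcs, \<open>snd (hd p)\<close> is an arbitrary vertex, and any \<open>w\<close> gives a contradiction.\<close>
  have "\<exists>w \<in> neighbors G u \<inter> S. w \<noteq> snd (hd p)"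
  proof (rule ccontr)
    assume "\<not> ?thesis"
    then have "neighbors G u \<inter> S \<subseteq> {snd (hd p)}" by auto
    then have "card (neighbors G u \<inter> S) \<le> 1"
      by (metis card_mono finite.emptyI finite.insertI is_singletonI is_singleton_altdef)
    then show False using two[OF \<open>u \<in> S\<close>] by simp
  qed
  then obtain w where w: "w \<in> neighbors G u" "w \<in> S" "w \<noteq> snd (hd p)" by auto
  obtain q r where qr: "p = q @ r" "awalk u q w" "distinct (awalk_verts u q)"
    using on_path[OF w(1,2)] path awalk_decomp[of u p v w]
    by (metis apath_append_iff apath_def)
  have "w \<noteq> u" using w(1) not_neighbor_self by auto
  have "2 \<le> length q"
  proof (cases q)
    case Nil
    then show ?thesis using qr(2) \<open>w \<noteq> u\<close> by (auto simp: awalk_Nil_iff)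
  next
    case (Cons e q')
    show ?thesis
    proof (cases q')
      case Nil
      then have "w = snd (hd p)" using qr(1,2) Cons by (auto simp: awalk_Cons_iff awalk_Nil_iff)
      then show ?thesis using w(3) by simp
    qed (simp add: Cons)
  qed
  moreover have "(w, u) \<in> parcs G" using w(1) by (auto simp: neighbors_def dest: arcs_symmetric)
  then have "cycle ((w, u) # q)"
    unfolding cycle_def using qr(2,3) by (intro exI[of _ w]) (auto simp: awalk_Cons_iff)
  ultimately show False using forest by (fastforce simp: undirected_forest_def)
qed

text \<open>
  Remove vertices with at most one remaining neighbor one after the other, and rank the vertices by
  the time of their removal.
\<close>

lemma forest_ex_rank:
  assumes forest: "undirected_forest G" and "S \<subseteq> pverts G"
  shows "\<exists>rank :: 'a \<Rightarrow> nat. inj_on rank S \<and>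
    (\<forall>v\<in>S. card {w \<in> neighbors G v \<inter> S. rank v < rank w} \<le> 1)"
proof -
  have "finite S" using assms(2) pair_finite_verts finite_subset by blast
  then show ?thesis using assms(2)
  proof (induction S rule: finite_psubset_induct)
    case (psubset S)
    show ?case
    proof (cases "S = {}")
      case False
      obtain v where v: "v \<in> S" "card (neighbors G v \<inter> S) \<le> 1"
        using forest_ex_end_vertex[OF forest psubset.prems False] by blast
      have "S - {v} \<subset> S" "S - {v} \<subseteq> pverts G" using psubset.prems v(1) by auto
      from psubset.IH[OF this] obtain rank :: "'a \<Rightarrow> nat" where rank: "inj_on rank (S - {v})"
        "\<forall>x\<in>S - {v}. card {w \<in> neighbors G x \<inter> (S - {v}). rank x < rank w} \<le> 1"
        by (elim exE conjE)
      define rank' where "rank' x = (if x = v then 0 else Suc (rank x))" for x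
      have "inj_on rank' S"
        using rank(1) by (auto simp: rank'_def inj_on_def)
      moreover have "card {w \<in> neighbors G x \<inter> S. rank' x < rank' w} \<le> 1" if "x \<in> S" for x
      proof (cases "x = v")
        case True
        have "card {w \<in> neighbors G v \<inter> S. rank' v < rank' w} \<le> card (neighbors G v \<inter> S)"
          by (rule card_mono) (auto simp: finite_neighbors)
        then show ?thesis using v(2) True by simp
      next
        case False
        then have "{w \<in> neighbors G x \<inter> S. rank' x < rank' w}
            = {w \<in> neighbors G x \<inter> (S - {v}). rank x < rank w}"
          by (auto simp: rank'_def)
        then show ?thesis using rank(2) that False by simp
      qed
      ultimately show ?thesis by (intro exI[of _ rank'] conjI ballI)
    qed auto
  qed
qed

end

section \<open>Saturated vertices below uncolored parents\<close>

text \<open>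
  The rank roots the forest: the parent of a vertex is its neighbor of higher rank, and the
  children are the neighbors of lower rank.
\<close>

locale ranked_forest = pair_graph G for G :: "'a pair_pre_digraph" +
  fixes rank :: "'a \<Rightarrow> nat"
  assumes rank_neq: "w \<in> neighbors G v \<Longrightarrow> rank w \<noteq> rank v"
    and higher_neighbor_unique:
      "\<lbrakk>w \<in> neighbors G v; w' \<in> neighbors G v; rank v < rank w; rank v < rank w'\<rbrakk> \<Longrightarrow> w = w'"
begin

definition is_parent :: "'a \<Rightarrow> 'a \<Rightarrow> bool" where
  "is_parent w v \<longleftrightarrow> w \<in> neighbors G v \<and> rank v < rank w"

lemma is_parent_unique: "is_parent w v \<Longrightarrow> is_parent w' v \<Longrightarrow> w = w'"
  using higher_neighbor_unique by (auto simp: is_parent_def)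

lemma neighbor_cases: "w \<in> neighbors G v \<Longrightarrow> is_parent w v \<or> is_parent v w"
  using rank_neq[of w v] neighbors_sym[of w v] by (auto simp: is_parent_def)

definition saturated :: "('a \<rightharpoonup> 'c) \<Rightarrow> 'a \<Rightarrow> bool" where
  "saturated c v \<longleftrightarrow>
     v \<in> dom c \<and> out_degree G v div 2 \<le> card {w \<in> neighbors G v. c w = c v}"

text \<open>
  An exposed vertex is a threat to its parent, and together with two others it could make the parent
  uncolorable.
\<close>

definition exposed :: "('a \<rightharpoonup> 'c) \<Rightarrow> 'a set" where
  "exposed c = {v. saturated c v \<and> (\<exists>w. is_parent w v \<and> c w = None)}"

definition safe :: "('a \<rightharpoonup> 'c) \<Rightarrow> bool" where
  "safe c \<longleftrightarrow> majority_condition G c \<and> exposed c = {}"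

text \<open>The positions that Bob can leave behind: at most one vertex needs repair.\<close>

definition almost_safe :: "('a \<rightharpoonup> 'c) \<Rightarrow> bool" where
  "almost_safe c \<longleftrightarrow> majority_condition G c \<and> (\<exists>a. exposed c \<subseteq> {a})"

lemma same_colored_update:
  assumes "c x = None" "v \<in> dom c"
  shows "{w \<in> neighbors G v. (c(x \<mapsto> \<alpha>)) w = (c(x \<mapsto> \<alpha>)) v} =
    (if x \<in> neighbors G v \<and> c v = Some \<alpha> then insert x {w \<in> neighbors G v. c w = c v}
     else {w \<in> neighbors G v. c w = c v})"
  using assms by auto

text \<open>
  A vertex \<open>v \<noteq> x\<close> can only become exposed by gaining the neighbor \<open>x\<close> of its own color.  As \<open>v\<close> has
  an uncolored parent, \<open>x\<close> is not that parent, so \<open>v\<close> is the parent of \<open>x\<close>; and since \<open>v\<close> is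
  colored, \<open>x\<close> is then not exposed itself.
\<close>

lemma legal_move_almost_safe:
  assumes safe: "safe c" and legal: "legal_move G C c (x, \<alpha>)"
  shows "almost_safe (c(x \<mapsto> \<alpha>))"
proof -
  let ?c = "c(x \<mapsto> \<alpha>)"
  have x: "c x = None" "majority_condition G ?c" using legal by auto
  have parent: "is_parent v x \<and> v \<in> dom c" if v: "v \<in> exposed ?c" "v \<noteq> x" for v
  proof -
    obtain w where w: "is_parent w v" "c w = None" "w \<noteq> x" and sat: "saturated ?c v"
      using v(1) by (auto simp: exposed_def split: if_splits)
    have dom: "v \<in> dom c" using sat v(2) by (auto simp: saturated_def)
    have "x \<in> neighbors G v \<and> c v = Some \<alpha>"
    proof (rule ccontr)
      assume "\<not> ?thesis"
      then have "saturated c v"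
        using sat dom unfolding saturated_def same_colored_update[OF x(1) dom] by (simp only: if_False)
      then have "v \<in> exposed c" using w by (auto simp: exposed_def)
      then show False using safe by (simp add: safe_def)
    qed
    then show ?thesis using neighbor_cases[of x v] is_parent_unique[of x v w] w dom by blast
  qed
  have "\<exists>a. exposed ?c \<subseteq> {a}"
  proof (cases "x \<in> exposed ?c")
    case True
    then obtain w where w: "is_parent w x" "c w = None"
      by (auto simp: exposed_def split: if_splits)
    have "exposed ?c \<subseteq> {x}"
      using parent is_parent_unique[OF w(1)] w(2) by fastforce
    then show ?thesis by blast
  next
    case False
    then have "\<And>v. v \<in> exposed ?c \<Longrightarrow> is_parent v x" using parent by metis
    then show ?thesis using is_parent_unique by blast
  qed
  then show ?thesis using x(2) by (simp add: almost_safe_def)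
qed

text \<open>
  Sufficient conditions for a move at \<open>n\<close> to restore safety.  The neighbors of color \<open>\<alpha>\<close> are
  children of \<open>n\<close>, and as they are not exposed while their parent \<open>n\<close> is uncolored, they are
  unsaturated and tolerate one more neighbor of color \<open>\<alpha>\<close>.  All vertices that were exposed
  before have the parent \<open>n\<close> and hence are exposed no longer.
\<close>

lemma coloring_makes_safe:
  assumes maj: "majority_condition G c"
    and n: "n \<in> pverts G" "c n = None" and \<alpha>: "\<alpha> \<in> C"
    and few: "card {u \<in> neighbors G n. c u = Some \<alpha>} \<le> out_degree G n div 2"
    and parent_color: "\<And>w. is_parent w n \<Longrightarrow> c w \<noteq> Some \<alpha>"
    and slack: "\<And>w. \<lbrakk>is_parent w n; c w = None\<rbrakk>
        \<Longrightarrow> card {u \<in> neighbors G n. c u = Some \<alpha>} < out_degree G n div 2"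
    and exp: "\<And>a. a \<in> exposed c \<Longrightarrow> is_parent n a \<and> c a \<noteq> Some \<alpha>"
  shows "legal_move G C c (n, \<alpha>) \<and> safe (c(n \<mapsto> \<alpha>))"
proof -
  let ?c = "c(n \<mapsto> \<alpha>)"
  have at_n: "{w \<in> neighbors G n. ?c w = ?c n} = {u \<in> neighbors G n. c u = Some \<alpha>}"
    using not_neighbor_self by auto
  have child: "is_parent n v" if "n \<in> neighbors G v" "c v = Some \<alpha>" for v
    using neighbor_cases[OF that(1)] parent_color that(2) by blast
  have "card {w \<in> neighbors G v. ?c w = ?c v} \<le> out_degree G v div 2" if v: "v \<in> dom ?c" for v
  proof (cases "v = n")
    case True
    then show ?thesis using few at_n by simp
  next
    case False
    then have dom: "v \<in> dom c" using v by auto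
    have old: "card {w \<in> neighbors G v. c w = c v} \<le> out_degree G v div 2"
      using maj dom by (auto simp: majority_condition_def)
    show ?thesis
    proof (cases "n \<in> neighbors G v \<and> c v = Some \<alpha>")
      case True
      then have "v \<notin> exposed c" using exp by blast
      then have "\<not> saturated c v" using child True n(2) unfolding exposed_def by blast
      then have "card {w \<in> neighbors G v. c w = c v} < out_degree G v div 2"
        using dom by (auto simp: saturated_def)
      then have "card (insert n {w \<in> neighbors G v. c w = c v}) \<le> out_degree G v div 2"
        using finite_neighbors True n(2) by simp
      then show ?thesis unfolding same_colored_update[OF n(2) dom] using True by (simp only: if_True simp_thms)
    next
      case False
      then show ?thesis using old unfolding same_colored_update[OF n(2) dom] using False by (simp only: if_False)
    qed
  qed
  then have maj': "majority_condition G ?c" unfolding majority_condition_def by blast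
  have "v \<notin> exposed ?c" for v
  proof
    assume "v \<in> exposed ?c"
    then obtain w where w: "is_parent w v" "c w = None" "w \<noteq> n" and sat: "saturated ?c v"
      by (auto simp: exposed_def split: if_splits)
    show False
    proof (cases "v = n")
      case True
      then show ?thesis using slack[of w] w sat unfolding saturated_def True at_n by simp
    next
      case False
      then have dom: "v \<in> dom c" using sat by (auto simp: saturated_def)
      have not_parent: "\<not> is_parent n v" using is_parent_unique[OF w(1)] w(3) by blast
      then have "\<not> (n \<in> neighbors G v \<and> c v = Some \<alpha>)" using child by blast
      then have "saturated c v"
        using sat dom unfolding saturated_def same_colored_update[OF n(2) dom] by (simp only: if_False)
      then have "v \<in> exposed c" using w by (auto simp: exposed_def)
      then show False using exp not_parent by blast
    qed
  qed
  then show ?thesis using maj' n \<alpha> by (auto simp: safe_def)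
qed

lemma card_two_colors:
  assumes "\<beta> \<noteq> \<gamma>" "U \<subseteq> neighbors G n" "\<And>u. u \<in> U \<Longrightarrow> c u \<noteq> Some \<beta> \<and> c u \<noteq> Some \<gamma>"
  shows "card {u \<in> neighbors G n. c u = Some \<beta>} + card {u \<in> neighbors G n. c u = Some \<gamma>} + card U
    \<le> out_degree G n"
proof -
  let ?B = "{u \<in> neighbors G n. c u = Some \<beta>}" and ?D = "{u \<in> neighbors G n. c u = Some \<gamma>}"
  have fin: "finite U" "finite ?B" "finite ?D"
    using assms(2) finite_neighbors finite_subset by auto
  have "?B \<inter> ?D = {}" "(?B \<union> ?D) \<inter> U = {}" using assms(1,3) by auto
  then have "card ?B + card ?D + card U = card (?B \<union> ?D \<union> U)"
    using fin by (simp add: card_Un_disjoint)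
  also have "\<dots> \<le> card (neighbors G n)"
    by (rule card_mono[OF finite_neighbors]) (use assms(2) in auto)
  finally show ?thesis by (simp add: out_degree_eq_card_neighbors)
qed

text \<open>
  If the set \<open>U\<close> of neighbors excludes no more than one color, two colors remain, and the rarer of
  them occurs on at most half of the neighbors outside \<open>U\<close>.  Uncolored vertices may be put into \<open>U\<close>
  to improve the bound.
\<close>

lemma rare_color:
  assumes C: "3 \<le> card C" and U: "U \<subseteq> neighbors G n" and one: "card (Some -` c ` U) \<le> 1"
  obtains \<alpha> where "\<alpha> \<in> C" "\<And>u. u \<in> U \<Longrightarrow> c u \<noteq> Some \<alpha>"
    "2 * card {u \<in> neighbors G n. c u = Some \<alpha>} + card U \<le> out_degree G n"
proof -
  let ?cnt = "\<lambda>\<alpha>. card {u \<in> neighbors G n. c u = Some \<alpha>}"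
  have "finite (Some -` c ` U)"
    using U finite_neighbors finite_subset by (metis finite_imageI finite_vimageI inj_Some)
  then have "2 \<le> card (C - Some -` c ` U)"
    using C one diff_card_le_card_Diff[of "Some -` c ` U" C] by simp
  then obtain \<beta> \<gamma> where bg: "\<beta> \<in> C - Some -` c ` U" "\<gamma> \<in> C - Some -` c ` U" "\<beta> \<noteq> \<gamma>"
    by (metis One_nat_def card_le_Suc0_iff_eq card.infinite not_less_eq_eq numeral_2_eq_2 zero_le)
  have sum: "?cnt \<beta> + ?cnt \<gamma> + card U \<le> out_degree G n"
    using bg by (intro card_two_colors[OF _ U]) (auto intro: rev_image_eqI)
  show thesis
  proof (cases "?cnt \<beta> \<le> ?cnt \<gamma>")
    case True
    then show thesis using bg(1) sum by (intro that[of \<beta>]) (force intro: rev_image_eqI)+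
  next
    case False
    then show thesis using bg(2) sum by (intro that[of \<gamma>]) (force intro: rev_image_eqI)+
  qed
qed

definition safe_move :: "'c set \<Rightarrow> ('a \<rightharpoonup> 'c) \<Rightarrow> ('a, 'c) move \<Rightarrow> bool" where
  "safe_move C c m \<longleftrightarrow> legal_move G C c m \<and> safe (c(fst m \<mapsto> snd m))"

text \<open>
  The degree bound enters where the vertex \<open>n\<close> to be colored has both an exposed child and a colored
  parent: the colors of these two are excluded, and the third color may occur on all other
  neighbors of \<open>n\<close>.
\<close>

lemma ex_safe_move:
  assumes deg: "\<And>v. v \<in> pverts G \<Longrightarrow> out_degree G v \<le> 4" and C: "3 \<le> card C"
    and almost: "almost_safe c"
    and uncolored: "\<exists>v\<in>pverts G. c v = None"
  shows "\<exists>m. safe_move C c m"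
proof -
  have maj: "majority_condition G c" using almost by (simp add: almost_safe_def)
  have "\<exists>n \<alpha>. legal_move G C c (n, \<alpha>) \<and> safe (c(n \<mapsto> \<alpha>))"
  proof (cases "exposed c = {}")
    case True
    let ?U = "{v \<in> pverts G. c v = None}"
    have "finite (rank ` ?U)" "rank ` ?U \<noteq> {}" using uncolored pair_finite_verts by auto
    then have "Max (rank ` ?U) \<in> rank ` ?U" "\<And>v. v \<in> ?U \<Longrightarrow> rank v \<le> Max (rank ` ?U)"
      by (rule Max_in) (use \<open>finite (rank ` ?U)\<close> in simp)
    then obtain n where n: "n \<in> pverts G" "c n = None"
      and top: "\<And>v. v \<in> pverts G \<Longrightarrow> c v = None \<Longrightarrow> rank v \<le> rank n"
      by (smt (verit) imageE mem_Collect_eq)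
    have parent_colored: "c w \<noteq> None" if "is_parent w n" for w
      using that top[of w] neighbors_subset_pverts by (fastforce simp: is_parent_def)
    define U where "U = {w. is_parent w n}"
    have "\<And>w. w \<in> U \<Longrightarrow> is_parent w n" by (simp add: U_def)
    then have "\<exists>w. U \<subseteq> {w}" using is_parent_unique by blast
    then obtain w where "U \<subseteq> {w}" by blast
    then have "Some -` c ` U \<subseteq> {the (c w)}" by (cases "c w") auto
    then have one: "card (Some -` c ` U) \<le> 1" using card_mono[of "{the (c w)}"] by simp
    have U: "U \<subseteq> neighbors G n" by (auto simp: U_def is_parent_def)
    obtain \<alpha> where \<alpha>: "\<alpha> \<in> C" "\<And>u. u \<in> U \<Longrightarrow> c u \<noteq> Some \<alpha>"
      "2 * card {u \<in> neighbors G n. c u = Some \<alpha>} + card U \<le> out_degree G n"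
      using rare_color[OF C U one] by blast
    have "legal_move G C c (n, \<alpha>) \<and> safe (c(n \<mapsto> \<alpha>))"
      using \<alpha> n True
      by (intro coloring_makes_safe[OF maj]) (auto simp: U_def dest: parent_colored)
    then show ?thesis by blast
  next
    case False
    then obtain a where a: "exposed c = {a}"
      using almost by (auto simp: almost_safe_def)
    then obtain n where n: "is_parent n a" "c n = None" and sat: "saturated c a"
      unfolding exposed_def by blast
    have "a \<in> dom c" using sat by (simp add: saturated_def)
    have nv: "n \<in> pverts G" using n(1) neighbors_subset_pverts by (auto simp: is_parent_def)
    have an: "a \<in> neighbors G n" "\<not> is_parent a n"
      using n(1) neighbors_sym by (auto simp: is_parent_def)
    have key: ?thesis if "\<alpha> \<in> C" "c a \<noteq> Some \<alpha>"
      "\<And>w. is_parent w n \<Longrightarrow> c w \<noteq> Some \<alpha>"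
      "card {u \<in> neighbors G n. c u = Some \<alpha>} \<le> out_degree G n div 2"
      "\<And>w. is_parent w n \<Longrightarrow> c w = None \<Longrightarrow>
        card {u \<in> neighbors G n. c u = Some \<alpha>} < out_degree G n div 2" for \<alpha>
    proof (intro exI)
      show "legal_move G C c (n, \<alpha>) \<and> safe (c(n \<mapsto> \<alpha>))"
        by (rule coloring_makes_safe[OF maj nv n(2)]) (use that a n(1) in auto)
    qed
    consider (root) "\<And>w. \<not> is_parent w n"
      | (uncol) w where "is_parent w n" "c w = None"
      | (col) w where "is_parent w n" "c w \<noteq> None" by blast
    then show ?thesis
    proof cases
      case root
      have "card (Some -` c ` {a}) \<le> 1" using \<open>a \<in> dom c\<close> by (auto simp: vimage_def)
      then obtain \<alpha> where "\<alpha> \<in> C" "c a \<noteq> Some \<alpha>"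
        "2 * card {u \<in> neighbors G n. c u = Some \<alpha>} + card {a} \<le> out_degree G n"
        using rare_color[OF C, of "{a}" n c] an by auto
      then show ?thesis using root by (intro key) auto
    next
      case uncol
      have "Some -` c ` {a, w} = {the (c a)}" using \<open>a \<in> dom c\<close> uncol by auto
      then have "card (Some -` c ` {a, w}) \<le> 1" by simp
      moreover have "w \<in> neighbors G n" "a \<noteq> w" using uncol an by (auto simp: is_parent_def)
      ultimately obtain \<alpha> where "\<alpha> \<in> C" "c a \<noteq> Some \<alpha>"
        "2 * card {u \<in> neighbors G n. c u = Some \<alpha>} + card {a, w} \<le> out_degree G n"
        using rare_color[OF C, of "{a, w}" n c] an by auto
      then show ?thesis using uncol \<open>a \<noteq> w\<close>
        by (intro key) (auto dest: is_parent_unique[OF uncol(1)])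
    next
      case col
      have w: "w \<in> neighbors G n" "a \<noteq> w" using col an by (auto simp: is_parent_def)
      obtain \<alpha> where \<alpha>: "\<alpha> \<in> C" "\<alpha> \<notin> {the (c a), the (c w)}"
      proof -
        have "\<not> C \<subseteq> {the (c a), the (c w)}"
          using C card_mono[of "{the (c a), the (c w)}" C] card_insert_le_m1[of 2 "{the (c w)}" "the (c a)"]
          by auto
        then show thesis using that by blast
      qed
      then have neq: "c a \<noteq> Some \<alpha>" "c w \<noteq> Some \<alpha>" by auto
      have "{u \<in> neighbors G n. c u = Some \<alpha>} \<subseteq> neighbors G n - {a, w}" using neq by auto
      then have "card {u \<in> neighbors G n. c u = Some \<alpha>} \<le> card (neighbors G n - {a, w})"
        by (intro card_mono) (auto simp: finite_neighbors)
      also have "\<dots> = out_degree G n - 2"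
        using w an by (simp add: card_Diff_subset out_degree_eq_card_neighbors)
      also have "\<dots> \<le> out_degree G n div 2" using deg[OF nv] by simp
      finally show ?thesis using \<alpha> neq col
        by (intro key) (auto dest: is_parent_unique[OF col(1)])
    qed
  qed
  then show ?thesis by (auto simp: safe_move_def)
qed

section \<open>The strategy\<close>

text \<open>
  Alice makes a safe move if there is one.  The other case does not occur in plays that follow the
  strategy, but a strategy has to answer every legal play.
\<close>

definition safe_strategy :: "'c set \<Rightarrow> ('a, 'c) strategy" where
  "safe_strategy C ms =
     (if \<exists>m. safe_move C (map_of ms) m then SOME m. safe_move C (map_of ms) m
      else SOME m. legal_move G C (map_of ms) m)"

lemma safe_move_safe_strategy:
  "safe_move C (map_of ms) m \<Longrightarrow> safe_move C (map_of ms) (safe_strategy C ms)"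
  unfolding safe_strategy_def by (subst if_P) (blast intro: someI)+

lemma alice_strategy_safe_strategy: "alice_strategy G C (safe_strategy C)"
  unfolding alice_strategy_def
proof (intro allI impI)
  fix ms
  assume "legal_play G C ms \<and> even (length ms) \<and> \<not> game_over G C ms"
  then have ex: "\<exists>m. legal_move G C (map_of ms) m" by (simp add: game_over_def)
  show "legal_move G C (map_of ms) (safe_strategy C ms)"
  proof (cases "\<exists>m. safe_move C (map_of ms) m")
    case True
    then show ?thesis using safe_move_safe_strategy safe_move_def by blast
  next
    case False
    then have "safe_strategy C ms = (SOME m. legal_move G C (map_of ms) m)"
      unfolding safe_strategy_def by (simp only: if_False)
    then show ?thesis using someI_ex[OF ex] by simp
  qed
qed

lemma safe_imp_almost_safe: "safe c \<Longrightarrow> almost_safe c"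
  by (simp add: safe_def almost_safe_def)

lemma map_of_snoc_legal:
  assumes "legal_move G C (map_of ms) m"
  shows "map_of (ms @ [m]) = (map_of ms)(fst m \<mapsto> snd m)"
  using assms by (cases m) (simp del: map_of_append fun_upd_apply add: map_of_snoc)

lemma safe_strategy_invariant:
  assumes deg: "\<And>v. v \<in> pverts G \<Longrightarrow> out_degree G v \<le> 4" and C: "3 \<le> card C"
    and "legal_play G C ms" "alice_follows (safe_strategy C) ms"
  shows "(even (length ms) \<longrightarrow> almost_safe (map_of ms)) \<and> (odd (length ms) \<longrightarrow> safe (map_of ms))"
  using assms(3,4)
proof (induction rule: legal_play.induct)
  case start
  have "saturated (\<lambda>_. None :: 'c option) v \<Longrightarrow> False" for v by (simp add: saturated_def)
  then show ?case by (auto simp: almost_safe_def exposed_def majority_condition_def)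
next
  case (move ms m)
  have "alice_follows (safe_strategy C) ms"
    unfolding alice_follows_def
  proof (intro allI impI)
    fix i assume "i < length ms" "even i"
    then show "ms ! i = safe_strategy C (take i ms)"
      using move.prems[unfolded alice_follows_def, rule_format, of i] by (simp add: nth_append)
  qed
  note IH = move.IH[OF this]
  note snoc = map_of_snoc_legal[OF move.hyps(2)]
  show ?case
  proof (cases "even (length ms)")
    case True
    then have m: "m = safe_strategy C ms"
      using move.prems by (auto simp: alice_follows_def dest!: spec[of _ "length ms"])
    have "\<exists>v\<in>pverts G. map_of ms v = None" using move.hyps(2) by (cases m) auto
    then have "\<exists>m'. safe_move C (map_of ms) m'"
      using ex_safe_move[OF deg C] IH True by blast
    then have "safe ((map_of ms)(fst m \<mapsto> snd m))"
      using safe_move_safe_strategy m unfolding safe_move_def by blast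
    then show ?thesis using True snoc by (simp del: map_of_append fun_upd_apply)
  next
    case False
    then have "almost_safe ((map_of ms)(fst m \<mapsto> snd m))"
      using legal_move_almost_safe[of "map_of ms" C "fst m" "snd m"] IH move.hyps(2) by simp
    then show ?thesis using False snoc by (simp del: map_of_append fun_upd_apply)
  qed
qed

lemma alice_wins_three_colors:
  assumes deg: "\<And>v. v \<in> pverts G \<Longrightarrow> out_degree G v \<le> 4" and C: "3 \<le> card C"
  shows "alice_wins G C"
proof -
  have "dom (map_of ms) = pverts G"
    if ms: "legal_play G C ms" "alice_follows (safe_strategy C) ms" "game_over G C ms" for ms
  proof (rule ccontr)
    assume "dom (map_of ms) \<noteq> pverts G"
    then have "\<not> pverts G \<subseteq> dom (map_of ms)" using legal_play_dom[OF ms(1)] by simp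
    then have "\<exists>v\<in>pverts G. map_of ms v = None" by auto
    moreover have "almost_safe (map_of ms)"
      using safe_strategy_invariant[OF deg C ms(1,2)] safe_imp_almost_safe by blast
    ultimately show False
      using ex_safe_move[OF deg C, of "map_of ms"] ms(3)
      unfolding game_over_def safe_move_def by blast
  qed
  then show ?thesis
    using alice_strategy_safe_strategy unfolding alice_wins_def alice_winning_strategy_def by blast
qed

end

theorem theorem1p1:
  fixes G :: "'a pair_pre_digraph"
  assumes "pair_graph G"
    and "undirected_forest G"
    and "max_degree G \<le> 4"
  shows "majority_game_chromatic_number G \<le> 3"
proof -
  interpret pair_graph G by fact
  have deg: "out_degree G v \<le> 4" if "v \<in> pverts G" for v
  proof -
    have "out_degree G v \<le> max_degree G"
      unfolding max_degree_def using that pair_finite_verts by (intro Max_ge) auto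
    then show ?thesis using assms(3) by simp
  qed
  obtain rank :: "'a \<Rightarrow> nat" where inj: "inj_on rank (pverts G)"
    and one: "\<And>v. v \<in> pverts G \<Longrightarrow>
      card {w \<in> neighbors G v \<inter> pverts G. rank v < rank w} \<le> 1"
    using forest_ex_rank[OF assms(2) order_refl] by blast
  interpret ranked_forest G rank
  proof
    fix v w assume w: "w \<in> neighbors G v"
    then have "v \<in> neighbors G w" using neighbors_sym by blast
    then show "rank w \<noteq> rank v"
      using w inj neighbors_subset_pverts not_neighbor_self by (metis inj_onD subsetD)
    fix w' assume w': "w' \<in> neighbors G v" "rank v < rank w" "rank v < rank w'"
    let ?H = "{w \<in> neighbors G v \<inter> pverts G. rank v < rank w}"
    have "v \<in> pverts G" using \<open>v \<in> neighbors G w\<close> neighbors_subset_pverts by blast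
    then have "card ?H \<le> Suc 0" using one by simp
    moreover have "finite ?H" by (simp add: finite_neighbors)
    moreover have "w \<in> ?H" "w' \<in> ?H" using w w' neighbors_subset_pverts by auto
    ultimately show "w = w'" by (meson card_le_Suc0_iff_eq)
  qed
  have "alice_wins G {..<3::nat}" using deg by (intro alice_wins_three_colors) auto
  then show ?thesis unfolding majority_game_chromatic_number_def by (rule Least_le)
qed

end
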